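(* Let $E$ be a separable Banach space, $\phi$ a Young integrand on $\Omega\times E$, $x_0\in L_\phi(\Omega,E)$, and $f:\Omega\times E\to\mathbb{R}$ a measurable integrand satisfying the following condition: for almost every $\omega\in\Omega$ the function $f_\omega=f(\omega,\cdot)$ is Lipschitzian on every ball of $E$; and there exist two positive constants $c$ and $\lambda_0$ such that for every $\lambda>\lambda_0$ there exist $\beta>0$ and $u_\lambda\in L_1(\Omega,\mathbb{R})$ such that, for almost every $\omega$ and every $e\in E$, $$\sup_{e^*\in\partial^C f_\omega(x_0(\omega)+e)}\phi^*(\omega,\lambda e^* )\ \le\ c\,\phi(\omega,\beta e)+u_\lambda(\omega).$$ Then $f$ has the Fréchet-differential lower compactness property on $L_\phi(\Omega,E)$ at $x_0$.
   Context: $(\Omega,\mathbb{T},\mu)$ is a measure space with $\mu$ a $\sigma$-finite positive measure and $\mathbb{T}$ $\mu$-complete. A measurable integrand is a $\mathbb{T}\otimes\mathcal{B}(E)$-measurable function. $\partial^C$ denotes the Clarke subdifferential of a locally Lipschitz function. A Young function is a convex even function $E\to\overline{\mathbb{R}}_+$, continuous at $0$, vanishing at $0$, and tending to $+\infty$ as $\|e\|\to\infty$. A Young integrand is $\phi:\Omega\times E\to\overline{\mathbb{R}}_+$ with $\phi(\omega,\cdot)$ a Young function for every $\omega$; $\phi^*(\omega,e^* )=\sup_{e\in E}(\langle e^*,e\rangle-\phi(\omega,e))$. With $I_\phi(x)=\int^*_\Omega\phi(\omega,x(\omega))\,d\mu$ (upper integral: $\int^*_\Omega v\,d\mu=\inf\{\int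 u\,d\mu: u\in L_1(\Omega,\mathbb{R}),u\ge v\text{ a.e.}\}$), $L_\phi(\Omega,E)$ is the set of classes of measurable $x:\Omega\to E$ with $x\in t\{I_\phi\le1\}$ for some $t>0$, normed by $\|x\|_\phi=\inf\{t>0: x\in t\{I_\phi\le1\}\}$. A subset $X$ of $L_1(\Omega,\mathbb{R})$ is uniformly integrable if it is bounded in $L_1$ and for every $\epsilon>0$ there are $\eta>0$ and a measurable $K$ of finite measure with $\sup_{u\in X}\|u1_A\|_1<\epsilon$ whenever $\mu(A)\le\eta$, and $\sup_{u\in X}\|u1_{K^c}\|_1<\epsilon$. $f$ has the Fréchet-differential lower compactness property on a normed space $\mathcal{X}$ of measurable functions at $x_0$ if for every sequence $(r_n)_n$ of positive numbers converging to $0$ and every norm bounded sequence $(x_n)_n$ in $\mathcal{X}$ there is $n_0$ such that the negative parts of the functions $\omega\mapsto r_n^{-1}(f(\omega,x_0(\omega)+r_nx_n(\omega))-f(\omega,x_0(\omega)))$, $n\ge n_0$, form a uniformly integrable family in $L_1(\Omega,\mathbb{R})$. *)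

theory Defs
  imports "HOL-Analysis.Analysis"
begin

section \<open>Young functions and Young integrands\<close>

text \<open>In the convexity inequality the weights 0 and 1 are harmless, as \<open>0 * \<infinity> = 0\<close> in \<^typ>\<open>ereal\<close>.\<close>

definition young_function :: "('e::real_normed_vector \<Rightarrow> ereal) \<Rightarrow> bool" where
  "young_function \<psi> \<longleftrightarrow>
     (\<forall>e. 0 \<le> \<psi> e) \<and>
     (\<forall>e e'. \<forall>t\<in>{0..1::real}.
        \<psi> ((1 - t) *\<^sub>R e + t *\<^sub>R e') \<le> ereal (1 - t) * \<psi> e + ereal t * \<psi> e') \<and>
     (\<forall>e. \<psi> (- e) = \<psi> e) \<and>
     isCont \<psi> 0 \<and>
     \<psi> 0 = 0 \<and>
     (\<psi> \<longlongrightarrow> \<infinity>) at_infinity"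

text \<open>No measurability in \<open>\<omega>\<close> is required here; integrals of Young integrands are upper integrals.\<close>

definition young_integrand :: "'a measure \<Rightarrow> ('a \<Rightarrow> 'e::real_normed_vector \<Rightarrow> ereal) \<Rightarrow> bool" where
  "young_integrand M \<phi> \<longleftrightarrow> (\<forall>\<omega>\<in>space M. young_function (\<phi> \<omega>))"

definition conjugate_integrand ::
    "('a \<Rightarrow> 'e::real_normed_vector \<Rightarrow> ereal) \<Rightarrow> 'a \<Rightarrow> ('e \<Rightarrow>\<^sub>L real) \<Rightarrow> ereal" where
  "conjugate_integrand \<phi> \<omega> e' = (SUP e. ereal (blinfun_apply e' e) - \<phi> \<omega> e)"


section \<open>Upper integral and the space \<open>L\<^sub>\<phi>\<close>\<close>

text \<open>The infimum is taken in \<^typ>\<open>ereal\<close>, so it is \<open>\<infinity>\<close> if \<open>v\<close> has no integrable majorant.\<close>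

definition upper_integral :: "'a measure \<Rightarrow> ('a \<Rightarrow> ereal) \<Rightarrow> ereal" where
  "upper_integral M v =
     (INF u \<in> {u :: 'a \<Rightarrow> real. integrable M u \<and> (AE \<omega> in M. v \<omega> \<le> ereal (u \<omega>))}.
        ereal (integral\<^sup>L M u))"

definition integral_functional ::
    "'a measure \<Rightarrow> ('a \<Rightarrow> 'e \<Rightarrow> ereal) \<Rightarrow> ('a \<Rightarrow> 'e) \<Rightarrow> ereal" where
  "integral_functional M \<phi> x = upper_integral M (\<lambda>\<omega>. \<phi> \<omega> (x \<omega>))"

text \<open>\<open>scaled_sublevel M \<phi> t\<close> is \<open>t{I\<^sub>\<phi> \<le> 1}\<close>. Elements of function spaces are represented by
  measurable functions instead of classes modulo equality almost everywhere.\<close>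

definition scaled_sublevel ::
    "'a measure \<Rightarrow> ('a \<Rightarrow> 'e::real_normed_vector \<Rightarrow> ereal) \<Rightarrow> real \<Rightarrow> ('a \<Rightarrow> 'e) set" where
  "scaled_sublevel M \<phi> t =
     (\<lambda>y \<omega>. t *\<^sub>R y \<omega>) ` {y \<in> borel_measurable M. integral_functional M \<phi> y \<le> 1}"

definition L_Young ::
    "'a measure \<Rightarrow> ('a \<Rightarrow> 'e::real_normed_vector \<Rightarrow> ereal) \<Rightarrow> ('a \<Rightarrow> 'e) set" where
  "L_Young M \<phi> = {x \<in> borel_measurable M. \<exists>t>0. x \<in> scaled_sublevel M \<phi> t}"

definition norm_Young ::
    "'a measure \<Rightarrow> ('a \<Rightarrow> 'e::real_normed_vector \<Rightarrow> ereal) \<Rightarrow> ('a \<Rightarrow> 'e) \<Rightarrow> real" where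
  "norm_Young M \<phi> x = Inf {t. t > 0 \<and> x \<in> scaled_sublevel M \<phi> t}"


section \<open>Clarke subdifferential\<close>

text \<open>The generalized directional derivative
  \<open>g\<^sup>o(x; v) = limsup (g (y + t v) - g y) / t\<close> as \<open>y \<rightarrow> x\<close> and \<open>t \<down> 0\<close>,
  where \<open>y = x\<close> is allowed.\<close>

definition clarke_dir_deriv :: "('e::real_normed_vector \<Rightarrow> real) \<Rightarrow> 'e \<Rightarrow> 'e \<Rightarrow> ereal" where
  "clarke_dir_deriv g x v =
     Limsup (nhds x \<times>\<^sub>F at_right (0::real)) (\<lambda>(y, t). ereal ((g (y + t *\<^sub>R v) - g y) / t))"

definition clarke_subdifferential ::
    "('e::real_normed_vector \<Rightarrow> real) \<Rightarrow> 'e \<Rightarrow> ('e \<Rightarrow>\<^sub>L real) set" where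
  "clarke_subdifferential g x =
     {e'. \<forall>v. ereal (blinfun_apply e' v) \<le> clarke_dir_deriv g x v}"


section \<open>Uniform integrability and the lower compactness property\<close>

definition L1_norm :: "'a measure \<Rightarrow> ('a \<Rightarrow> real) \<Rightarrow> ennreal" where
  "L1_norm M u = (\<integral>\<^sup>+ \<omega>. ennreal \<bar>u \<omega>\<bar> \<partial>M)"

definition uniformly_integrable :: "'a measure \<Rightarrow> ('a \<Rightarrow> real) set \<Rightarrow> bool" where
  "uniformly_integrable M X \<longleftrightarrow>
     (\<forall>u\<in>X. integrable M u) \<and>
     (SUP u\<in>X. L1_norm M u) < \<infinity> \<and>
     (\<forall>\<epsilon>>0. \<exists>\<eta>>0. \<exists>K\<in>sets M. emeasure M K < \<infinity> \<and>
        (\<forall>A\<in>sets M. emeasure M A \<le> ennreal \<eta> \<longrightarrow>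
           (SUP u\<in>X. L1_norm M (\<lambda>\<omega>. u \<omega> * indicator A \<omega>)) < ennreal \<epsilon>) \<and>
        (SUP u\<in>X. L1_norm M (\<lambda>\<omega>. u \<omega> * indicator (space M - K) \<omega>)) < ennreal \<epsilon>)"

text \<open>The normed space of measurable functions is given by its set of elements \<open>X\<close>
  and its norm \<open>N\<close>.\<close>

definition frechet_differential_lower_compact ::
    "'a measure \<Rightarrow> ('a \<Rightarrow> 'e::real_normed_vector) set \<Rightarrow> (('a \<Rightarrow> 'e) \<Rightarrow> real) \<Rightarrow>
     ('a \<Rightarrow> 'e \<Rightarrow> real) \<Rightarrow> ('a \<Rightarrow> 'e) \<Rightarrow> bool" where
  "frechet_differential_lower_compact M X N f x\<^sub>0 \<longleftrightarrow>
     (\<forall>(r :: nat \<Rightarrow> real) (x :: nat \<Rightarrow> 'a \<Rightarrow> 'e).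
        (\<forall>n. r n > 0) \<longrightarrow> r \<longlonglongrightarrow> 0 \<longrightarrow>
        (\<forall>n. x n \<in> X) \<longrightarrow> bdd_above (range (\<lambda>n. N (x n))) \<longrightarrow>
        (\<exists>n\<^sub>0. uniformly_integrable M
           ((\<lambda>n \<omega>. max 0 (- ((f \<omega> (x\<^sub>0 \<omega> + r n *\<^sub>R x n \<omega>) - f \<omega> (x\<^sub>0 \<omega>)) / r n))) ` {n\<^sub>0..})))"

end

theory Submission
  imports Defs
begin

text \<open>
  For a norm bounded sequence \<open>x\<^sub>n\<close> choose \<open>B\<close> above all its norms. Then \<open>\<phi>(\<omega>, x\<^sub>n(\<omega>) / B)\<close> has an
  integrable majorant \<open>v\<^sub>n\<close> of integral at most 2. The mean value theorem for Lipschitz functions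
  gives a Clarke subgradient \<open>e*\<close> of \<open>f\<^sub>\<omega>\<close> at a point between \<open>x\<^sub>0(\<omega>)\<close> and
  \<open>x\<^sub>0(\<omega>) + r\<^sub>n x\<^sub>n(\<omega>)\<close> such that the negative part of the difference quotient is at most
  \<open>\<langle>e*, - x\<^sub>n(\<omega>)\<rangle>\<close> wherever it is nonzero. Young's inequality for \<open>\<lambda>e*\<close> and \<open>- x\<^sub>n(\<omega>) / B\<close>,
  combined with the growth condition, bounds it by
  \<open>(B / \<lambda>) (\<phi>(\<omega>, x\<^sub>n(\<omega>) / B) + c \<phi>(\<omega>, \<beta> s r\<^sub>n x\<^sub>n(\<omega>)) + u\<^sub>\<lambda>(\<omega>))\<close> with some \<open>0 < s \<le> 1\<close>.
  As soon as \<open>\<beta> r\<^sub>n B \<le> 1\<close>, the second \<open>\<phi>\<close> is no larger than the first, which leaves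
  \<open>(B / \<lambda>) ((1 + c) v\<^sub>n(\<omega>) + \<bar>u\<^sub>\<lambda>(\<omega>)\<bar>)\<close>; this is lemma \<open>negative_quotient_bound\<close>.

  The decisive point is that \<open>c\<close> is independent of \<open>\<lambda>\<close>: as \<open>\<lambda>\<close> grows, the \<open>v\<^sub>n\<close> part becomes
  arbitrarily small in \<open>L\<^sub>1\<close>, uniformly in \<open>n\<close>, while the rest is one fixed integrable function. The
  finitely many indices for which \<open>r\<^sub>n\<close> is still too large for this \<open>\<lambda>\<close> are absorbed into the fixed
  function. A family that is dominated up to arbitrarily small \<open>L\<^sub>1\<close> errors is uniformly integrable
  (\<open>uniformly_integrable_if_almost_dominated\<close>).

  In the mean value theorem (\<open>clarke_mean_value_inequality\<close>) a one-sided inequality is enough. It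
  needs a subgradient that attains the generalized directional derivative in a prescribed
  direction, which is the Hahn-Banach theorem for the sublinear functional
  \<open>v \<mapsto> g\<^sup>o(z; v)\<close>.
\<close>

section \<open>Dominated linear functionals\<close>

text \<open>Positive homogeneity is stated as an inequality, which is all there is to check for a new
  functional; applied to \<open>1 / a\<close> it gives the reverse inequality.\<close>

definition sublinear :: "('e::real_vector \<Rightarrow> real) \<Rightarrow> bool" where
  "sublinear p \<longleftrightarrow> (\<forall>x y. p (x + y) \<le> p x + p y) \<and> (\<forall>a>0. \<forall>x. p (a *\<^sub>R x) \<le> a * p x)"

lemma sublinear_add: "sublinear p \<Longrightarrow> p (x + y) \<le> p x + p y"
  by (simp add: sublinear_def)

lemma sublinear_scaleR_le: "sublinear p \<Longrightarrow> a > 0 \<Longrightarrow> p (a *\<^sub>R x) \<le> a * p x"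
  by (simp add: sublinear_def)

lemma sublinear_scaleR:
  assumes "sublinear p" "a > 0"
  shows "p (a *\<^sub>R x) = a * p x"
proof -
  have "p ((1/a) *\<^sub>R (a *\<^sub>R x)) \<le> (1/a) * p (a *\<^sub>R x)"
    using assms by (intro sublinear_scaleR_le) auto
  then have "a * p x \<le> p (a *\<^sub>R x)"
    using assms(2) by (simp add: field_simps)
  then show ?thesis
    using sublinear_scaleR_le[OF assms] by (simp add: antisym)
qed

lemma sublinear_zero:
  assumes "sublinear p"
  shows "p 0 = 0"
  using sublinear_scaleR[OF assms, of 2 0] by simp

lemma sublinear_minus_ge:
  assumes "sublinear p"
  shows "- p (- x) \<le> p x"
  using sublinear_add[OF assms, of x "- x"] sublinear_zero[OF assms] by simp

text \<open>The functional \<open>q\<close> is the largest sublinear one below \<open>p\<close> that takes a value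
  \<open>\<le> - p h\<close> at \<open>- h\<close>. It serves twice: a minimal sublinear functional must coincide with it for
  every \<open>h\<close> and is therefore odd, and applied to \<open>p\<close> itself it forces a linear functional below
  \<open>q\<close> to touch \<open>p\<close> at \<open>h\<close>.\<close>

lemma sublinear_INF_below:
  fixes p :: "'e::real_vector \<Rightarrow> real"
  assumes p: "sublinear p"
  obtains q where "sublinear q" "q \<le> p" "q (- h) \<le> - p h"
proof
  define q where "q v = (INF s\<in>{0..}. p (v + s *\<^sub>R h) - s * p h)" for v
  have lb: "- p (- v) \<le> p (v + s *\<^sub>R h) - s * p h" if "s \<ge> 0" for v s
  proof -
    have "p (s *\<^sub>R h) = s * p h"
      using that sublinear_scaleR[OF p] sublinear_zero[OF p] by (cases "s = 0") auto
    then show ?thesis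
      using sublinear_add[OF p, of "- v" "v + s *\<^sub>R h"] by simp
  qed
  have bdd: "bdd_below ((\<lambda>s. p (v + s *\<^sub>R h) - s * p h) ` {0..})" for v
    using lb[of _ v] by (intro bdd_belowI2[of _ "- p (- v)"]) auto
  have le: "q v \<le> p (v + s *\<^sub>R h) - s * p h" if "s \<ge> 0" for v s
    unfolding q_def using that by (intro cINF_lower[OF bdd]) auto
  have ge: "b \<le> q v" if "\<And>s. s \<ge> 0 \<Longrightarrow> b \<le> p (v + s *\<^sub>R h) - s * p h" for b v
    unfolding q_def using that by (intro cINF_greatest) auto
  show "q \<le> p"
    using le[of 0] by (auto simp: le_fun_def)
  show "q (- h) \<le> - p h"
    using le[of 1 "- h"] sublinear_zero[OF p] by simp
  show "sublinear q"
    unfolding sublinear_def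
  proof (intro conjI allI impI)
    fix v w
    have "q (v + w) \<le> (p (v + s *\<^sub>R h) - s * p h) + (p (w + s' *\<^sub>R h) - s' * p h)"
      if "s \<ge> 0" "s' \<ge> 0" for s s'
    proof -
      have "(v + w) + (s + s') *\<^sub>R h = (v + s *\<^sub>R h) + (w + s' *\<^sub>R h)"
        by (simp add: algebra_simps)
      then have "p ((v + w) + (s + s') *\<^sub>R h) \<le> p (v + s *\<^sub>R h) + p (w + s' *\<^sub>R h)"
        using sublinear_add[OF p] by metis
      then show ?thesis
        using le[of "s + s'" "v + w"] that by (simp add: algebra_simps)
    qed
    then have "q (v + w) - (p (w + s' *\<^sub>R h) - s' * p h) \<le> q v" if "s' \<ge> 0" for s'
      using that by (intro ge) (simp add: algebra_simps)
    then have "q (v + w) - q v \<le> q w"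
      by (intro ge) (simp add: algebra_simps)
    then show "q (v + w) \<le> q v + q w"
      by simp
  next
    fix a :: real and v
    assume a: "a > 0"
    have "q (a *\<^sub>R v) / a \<le> p (v + s *\<^sub>R h) - s * p h" if "s \<ge> 0" for s
    proof -
      have "q (a *\<^sub>R v) \<le> p (a *\<^sub>R v + (a * s) *\<^sub>R h) - a * s * p h"
        using a that by (intro le) simp
      also have "a *\<^sub>R v + (a * s) *\<^sub>R h = a *\<^sub>R (v + s *\<^sub>R h)"
        by (simp add: algebra_simps)
      finally show ?thesis
        using a sublinear_scaleR[OF p a, of "v + s *\<^sub>R h"] by (simp add: field_simps)
    qed
    then have "q (a *\<^sub>R v) / a \<le> q v"
      by (rule ge)
    then show "q (a *\<^sub>R v) \<le> a * q v"
      using a by (simp add: field_simps)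
  qed
qed

text \<open>The pointwise infimum works; it is finite since \<open>f v \<ge> - f (- v) \<ge> - p (- v)\<close> for every
  \<open>f\<close> in the chain.\<close>

lemma sublinear_chain_bound:
  fixes p :: "'e::real_vector \<Rightarrow> real"
  assumes C: "C \<noteq> {}" "\<And>f. f \<in> C \<Longrightarrow> sublinear f" "\<And>f. f \<in> C \<Longrightarrow> f \<le> p"
    and chain: "\<And>f g. f \<in> C \<Longrightarrow> g \<in> C \<Longrightarrow> f \<le> g \<or> g \<le> f"
  obtains m where "sublinear m" "\<And>f. f \<in> C \<Longrightarrow> m \<le> f"
proof
  define m where "m v = (INF f\<in>C. f v)" for v
  have bdd: "bdd_below ((\<lambda>f. f v) ` C)" for v
  proof (intro bdd_belowI2[of _ "- p (- v)"])
    fix f assume "f \<in> C"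
    then have "f (- v) \<le> p (- v)" "- f (- v) \<le> f v"
      using C(3) sublinear_minus_ge[OF C(2)] by (auto simp: le_fun_def)
    then show "- p (- v) \<le> f v" by simp
  qed
  have le: "m v \<le> f v" if "f \<in> C" for f v
    unfolding m_def using that by (intro cINF_lower[OF bdd])
  have ge: "b \<le> m v" if "\<And>f. f \<in> C \<Longrightarrow> b \<le> f v" for b v
    unfolding m_def using C(1) that by (intro cINF_greatest)
  show "m \<le> f" if "f \<in> C" for f
    using le[OF that] by (simp add: le_fun_def)
  show "sublinear m"
    unfolding sublinear_def
  proof (intro conjI allI impI)
    fix v w
    have "m (v + w) \<le> f v + g w" if fg: "f \<in> C" "g \<in> C" for f g
    proof -
      \<comment> \<open>Subadditivity of the smaller of the two functions serves both arguments.\<close>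
      obtain k where k: "k \<in> C" "k \<le> f" "k \<le> g"
        using chain[OF fg] fg by blast
      have "m (v + w) \<le> k (v + w)" by (rule le[OF k(1)])
      also have "\<dots> \<le> k v + k w" by (rule sublinear_add[OF C(2)[OF k(1)]])
      also have "\<dots> \<le> f v + g w" using k by (intro add_mono) (auto simp: le_fun_def)
      finally show ?thesis .
    qed
    then have "m (v + w) - g w \<le> m v" if "g \<in> C" for g
      using that by (intro ge) (simp add: algebra_simps)
    then have "m (v + w) - m v \<le> m w"
      by (intro ge) (simp add: algebra_simps)
    then show "m (v + w) \<le> m v + m w"
      by simp
  next
    fix a :: real and v
    assume a: "a > 0"
    have "m (a *\<^sub>R v) / a \<le> m v"
    proof (rule ge)
      fix f assume f: "f \<in> C"
      show "m (a *\<^sub>R v) / a \<le> f v"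
        using le[OF f, of "a *\<^sub>R v"] sublinear_scaleR[OF C(2)[OF f] a, of v] a
        by (simp add: field_simps)
    qed
    then show "m (a *\<^sub>R v) \<le> a * m v"
      using a by (simp add: field_simps)
  qed
qed

text \<open>By Zorn's lemma there is a minimal sublinear functional below \<open>p\<close>. Minimality makes it odd,
  and an odd sublinear functional is linear.\<close>

lemma linear_below_sublinear:
  fixes p :: "'e::real_vector \<Rightarrow> real"
  assumes p: "sublinear p"
  obtains l where "linear l" "l \<le> p"
proof -
  define A where "A = {f. sublinear f \<and> f \<le> p}"
  \<comment> \<open>The order is reversed, as Zorn's lemma yields maximal elements.\<close>
  define below where "below f g \<longleftrightarrow> g \<le> f" for f g :: "'e \<Rightarrow> real"
  have "\<exists>m\<in>A. \<forall>f\<in>A. below m f \<longrightarrow> f = m"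
  proof (rule predicate_Zorn)
    show "partial_order_on A (relation_of below A)"
      by (rule partial_order_on_relation_ofI) (auto simp: below_def)
    fix C assume "C \<in> Chains (relation_of below A)"
    then have C: "C \<subseteq> A" and chain: "\<And>f g. f \<in> C \<Longrightarrow> g \<in> C \<Longrightarrow> f \<le> g \<or> g \<le> f"
      unfolding Chains_def relation_of_def below_def by auto
    show "\<exists>m\<in>A. \<forall>f\<in>C. below f m"
    proof (cases "C = {}")
      case True
      then show ?thesis using p by (auto simp: A_def)
    next
      case False
      obtain m where m: "sublinear m" "\<And>f. f \<in> C \<Longrightarrow> m \<le> f"
      proof (rule sublinear_chain_bound[OF False])
        show "sublinear f" "f \<le> p" if "f \<in> C" for f
          using that C by (auto simp: A_def)
      qed (use chain in auto)
      moreover have "m \<le> p"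
      proof -
        obtain f where "f \<in> C" using False by blast
        then have "m \<le> f" "f \<le> p" using m(2) C by (auto simp: A_def)
        then show ?thesis by (rule order_trans)
      qed
      ultimately show ?thesis
        by (auto simp: A_def below_def)
    qed
  qed
  then obtain l where "l \<in> A" and min_A: "\<And>f. f \<in> A \<Longrightarrow> f \<le> l \<Longrightarrow> f = l"
    unfolding below_def by blast
  then have l: "sublinear l" "l \<le> p"
    by (simp_all add: A_def)
  have min: "f = l" if "sublinear f" "f \<le> l" for f
    using min_A[of f] that order_trans[OF that(2) l(2)] by (simp add: A_def)
  have odd: "l (- h) = - l h" for h
  proof -
    obtain q where q: "sublinear q" "q \<le> l" "q (- h) \<le> - l h"
      using sublinear_INF_below[OF l(1)] .
    then have "q = l"
      using min by blast
    with q(3) show ?thesis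
      using sublinear_minus_ge[OF l(1), of h] by simp
  qed
  have "linear l"
  proof (rule linearI)
    fix v w
    show "l (v + w) = l v + l w"
      using sublinear_add[OF l(1), of v w] sublinear_add[OF l(1), of "- v" "- w"]
        odd[of v] odd[of w] odd[of "v + w"] by simp
  next
    fix a :: real and v
    show "l (a *\<^sub>R v) = a *\<^sub>R l v"
      using sublinear_scaleR[OF l(1), of a v] sublinear_scaleR[OF l(1), of "- a" v]
        odd[of "a *\<^sub>R v"] sublinear_zero[OF l(1)]
      by (cases a "0 :: real" rule: linorder_cases) auto
  qed
  with l(2) show thesis by (rule that[rotated -1])
qed

lemma linear_below_sublinear_touching:
  fixes p :: "'e::real_vector \<Rightarrow> real"
  assumes "sublinear p"
  obtains l where "linear l" "l \<le> p" "l h = p h"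
proof -
  obtain q where q: "sublinear q" "q \<le> p" "q (- h) \<le> - p h"
    using sublinear_INF_below[OF assms] .
  obtain l where l: "linear l" "l \<le> q"
    using linear_below_sublinear[OF q(1)] .
  have "l \<le> p"
    using l(2) q(2) by (rule order_trans)
  moreover have "- l h \<le> - p h"
    using l(2) q(3) linear_neg[OF l(1), of h] le_funD[OF l(2), of "- h"] by simp
  ultimately show thesis
    using l(1) le_funD[OF \<open>l \<le> p\<close>, of h] by (intro that[of l]) auto
qed

section \<open>Clarke subgradients along a segment\<close>

lemma filterlim_shifted_base:
  fixes z v :: "'e::real_normed_vector"
  shows "filterlim (\<lambda>(y, t). (y + t *\<^sub>R v, t)) (nhds z \<times>\<^sub>F at_right 0) (nhds z \<times>\<^sub>F at_right 0)"
proof -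
  have "((\<lambda>w. fst w + snd w *\<^sub>R v) \<longlongrightarrow> z + 0 *\<^sub>R v) (nhds z \<times>\<^sub>F at_right 0)"
    by (intro tendsto_intros filterlim_fst
        filterlim_mono[OF filterlim_snd _ order_refl] at_within_le_nhds)
  then show ?thesis
    by (auto simp: split_def intro!: filterlim_Pair filterlim_snd)
qed

text \<open>Near \<open>z\<close> all difference quotients in direction \<open>v\<close> lie in \<open>[- L \<parallel>v\<parallel>, L \<parallel>v\<parallel>]\<close>, so the limit
  superior is finite. It is subadditive because the quotient for \<open>v + w\<close> at the base point \<open>y\<close> is
  the quotient for \<open>v\<close> at \<open>y\<close> plus the quotient for \<open>w\<close> at \<open>y + t v\<close>, and this moved base point
  still tends to \<open>z\<close>. This is where letting \<open>y\<close> vary in the definition pays.\<close>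

lemma clarke_dir_deriv_sublinear:
  fixes g :: "'e::real_normed_vector \<Rightarrow> real"
  assumes lip: "L-lipschitz_on (ball z \<rho>) g" and \<rho>: "\<rho> > 0"
  obtains p where "sublinear p" "\<And>v. clarke_dir_deriv g z v = ereal (p v)"
    "\<And>v. \<bar>p v\<bar> \<le> L * norm v"
proof
  define F where "F = nhds z \<times>\<^sub>F at_right (0::real)"
  define Q where "Q v = (\<lambda>(y, t). (g (y + t *\<^sub>R v) - g y) / t)" for v
  define p where "p v = real_of_ereal (clarke_dir_deriv g z v)" for v
  have shift: "filterlim (\<lambda>(y, t). (y + t *\<^sub>R v, t)) F F" for v
    unfolding F_def by (rule filterlim_shifted_base)
  have F_ne: "F \<noteq> bot"
    unfolding F_def by (simp add: prod_filter_eq_bot)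
  have t_pos: "eventually (\<lambda>(y, t). t > 0) F"
    unfolding F_def using filterlim_snd[of "at_right (0::real)" "nhds z"]
    by (auto simp: split_def filterlim_iff eventually_at_right_less)
  have near: "eventually (\<lambda>(y, t). y \<in> ball z \<rho>) F"
  proof -
    have "eventually (\<lambda>y. y \<in> ball z \<rho>) (nhds z)"
      using \<rho> by (intro eventually_nhds_in_open) auto
    then show ?thesis
      unfolding F_def using filterlim_fst[of "nhds z" "at_right (0::real)"]
      by (auto simp: split_def filterlim_iff)
  qed
  have clarke: "clarke_dir_deriv g z v = Limsup F (\<lambda>w. ereal (Q v w))" for v
    unfolding clarke_dir_deriv_def F_def Q_def by (simp add: split_def)
  have Q_bound: "eventually (\<lambda>w. \<bar>Q v w\<bar> \<le> L * norm v) F" for v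
  proof -
    have "eventually (\<lambda>w. case (case w of (y, t) \<Rightarrow> (y + t *\<^sub>R v, t)) of (y, t) \<Rightarrow> y \<in> ball z \<rho>) F"
      using shift near by (auto simp: filterlim_iff)
    with near t_pos show ?thesis
    proof eventually_elim
      case (elim w)
      obtain y t where w: "w = (y, t)" by force
      have "\<bar>g (y + t *\<^sub>R v) - g y\<bar> \<le> L * (t * norm v)"
        using lipschitz_onD[OF lip, of "y + t *\<^sub>R v" y] elim w by (simp add: dist_norm)
      then show ?case
        using elim w by (simp add: Q_def field_simps)
    qed
  qed
  have upper: "clarke_dir_deriv g z v \<le> ereal b" if "eventually (\<lambda>w. Q v w \<le> b) F" for v b
    unfolding clarke using that by (intro Limsup_bounded) simp
  have "ereal (- (L * norm v)) \<le> clarke_dir_deriv g z v" for v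
    unfolding clarke
  proof (rule order_trans[OF Liminf_bounded Liminf_le_Limsup[OF F_ne]])
    show "eventually (\<lambda>w. ereal (- (L * norm v)) \<le> ereal (Q v w)) F"
      using Q_bound[of v] by eventually_elim auto
  qed
  moreover have "clarke_dir_deriv g z v \<le> ereal (L * norm v)" for v
    using Q_bound[of v] by (intro upper) (auto elim: eventually_mono)
  ultimately have *: "clarke_dir_deriv g z v = ereal (p v) \<and> \<bar>p v\<bar> \<le> L * norm v" for v
    unfolding p_def by (cases "clarke_dir_deriv g z v") (smt (verit) PInfty_neq_ereal
      ereal_less_eq MInfty_neq_ereal real_of_ereal.simps ereal_infty_less_eq)+
  then show "clarke_dir_deriv g z v = ereal (p v)" "\<bar>p v\<bar> \<le> L * norm v" for v
    by auto
  have below: "eventually (\<lambda>w. Q v w < p v + \<epsilon>) F" if "\<epsilon> > 0" for v \<epsilon>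
  proof -
    have "Limsup F (\<lambda>w. ereal (Q v w)) < ereal (p v + \<epsilon>)"
      using *[of v] that by (simp flip: clarke)
    from Limsup_lessD[OF this] show ?thesis by simp
  qed
  have p_le: "p v \<le> b" if "eventually (\<lambda>w. Q v w \<le> b) F" for v b
    using upper[OF that] *[of v] by simp
  show "sublinear p"
    unfolding sublinear_def
  proof (intro conjI allI impI)
    fix v w
    show "p (v + w) \<le> p v + p w"
    proof (rule field_le_epsilon)
      fix \<epsilon> :: real
      assume \<epsilon>: "\<epsilon> > 0"
      have "eventually (\<lambda>a. Q w (case a of (y, t) \<Rightarrow> (y + t *\<^sub>R v, t)) < p w + \<epsilon> / 2) F"
        using shift[of v] below[of "\<epsilon> / 2" w] \<epsilon> unfolding filterlim_iff by auto
      moreover have "eventually (\<lambda>a. Q v a < p v + \<epsilon> / 2) F"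
        using \<epsilon> by (intro below) simp
      ultimately show "p (v + w) \<le> p v + p w + \<epsilon>"
      proof (intro p_le, eventually_elim)
        case (elim a)
        moreover have "Q (v + w) a = Q w (case a of (y, t) \<Rightarrow> (y + t *\<^sub>R v, t)) + Q v a"
          unfolding Q_def
          by (simp add: split_def algebra_simps add_divide_distrib diff_divide_distrib)
        ultimately show ?case by simp
      qed
    qed
  next
    fix a :: real and v
    assume a: "a > 0"
    show "p (a *\<^sub>R v) \<le> a * p v"
    proof (rule field_le_epsilon)
      fix \<epsilon> :: real
      assume \<epsilon>: "\<epsilon> > 0"
      have scale: "filterlim (\<lambda>w. (fst w, a * snd w)) F F"
      proof -
        have "filterlim (\<lambda>t. a * t) (at_right 0) (at_right (0::real))"
          unfolding filterlim_at using a
          by (auto intro!: tendsto_eq_intros simp: eventually_at_right_less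
              intro: eventually_mono[OF eventually_at_right_less])
        then show ?thesis
          unfolding F_def
          by (intro filterlim_Pair filterlim_fst) (rule filterlim_compose[OF _ filterlim_snd])
      qed
      have "eventually (\<lambda>w. Q v (fst w, a * snd w) < p v + \<epsilon> / a) F"
        using scale below[of "\<epsilon> / a" v] \<epsilon> a unfolding filterlim_iff by auto
      then show "p (a *\<^sub>R v) \<le> a * p v + \<epsilon>"
      proof (intro p_le, eventually_elim)
        case (elim w)
        moreover have "Q (a *\<^sub>R v) w = a * Q v (fst w, a * snd w)"
          unfolding Q_def using a by (simp add: split_def mult.commute)
        ultimately show ?case
          using a by (simp add: field_simps)
      qed
    qed
  qed
qed

lemma clarke_subgradient_attaining:
  fixes g :: "'e::real_normed_vector \<Rightarrow> real"
  assumes lip: "L-lipschitz_on (ball z \<rho>) g" and \<rho>: "\<rho> > 0"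
  obtains e' where "e' \<in> clarke_subdifferential g z"
    "ereal (blinfun_apply e' h) = clarke_dir_deriv g z h"
proof -
  obtain p where p: "sublinear p" "\<And>v. clarke_dir_deriv g z v = ereal (p v)"
    "\<And>v. \<bar>p v\<bar> \<le> L * norm v"
    using clarke_dir_deriv_sublinear[OF assms] by blast
  obtain l where l: "linear l" "l \<le> p" "l h = p h"
    using linear_below_sublinear_touching[OF p(1)] .
  have "norm (l v) \<le> norm v * L" for v
  proof -
    have "l v \<le> p v" "l (- v) \<le> p (- v)"
      using l(2) by (auto simp: le_fun_def)
    then show ?thesis
      using p(3)[of v] p(3)[of "- v"] linear_neg[OF l(1), of v] by (simp add: mult.commute)
  qed
  then have "bounded_linear l"
    using l(1) by (auto simp: bounded_linear_def bounded_linear_axioms_def)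
  then have "blinfun_apply (Blinfun l) = l"
    by (rule bounded_linear_Blinfun_apply)
  with l(2,3) p(2) show thesis
    by (intro that[of "Blinfun l"]) (auto simp: clarke_subdifferential_def le_fun_def)
qed

text \<open>The one-sided half of Lebourg's mean value theorem. Along the segment, subtract from \<open>g\<close> the
  affine function with the same increment. The result takes equal values at both ends, hence has a
  minimum at some \<open>t < 1\<close>, and there the right difference quotients of \<open>g\<close> are at least
  \<open>g (a + h) - g a\<close>. So the generalized derivative in direction \<open>h\<close> is at least this large, and some
  subgradient attains it.\<close>

lemma clarke_mean_value_inequality:
  fixes g :: "'e::real_normed_vector \<Rightarrow> real"
  assumes lip: "\<And>z \<rho>. \<exists>L. L-lipschitz_on (ball z \<rho>) g"
  obtains t e' where "0 \<le> t" "t < 1" "e' \<in> clarke_subdifferential g (a + t *\<^sub>R h)"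
    "g (a + h) - g a \<le> blinfun_apply e' h"
proof -
  define m where "m = g (a + h) - g a"
  define k where "k t = g (a + t *\<^sub>R h) - t * m" for t
  have "isCont g z" for z
  proof -
    obtain L where "L-lipschitz_on (ball z 1) g" using lip by blast
    then have "continuous_on (ball z 1) g"
      by (rule lipschitz_on_continuous_on)
    then show ?thesis
      by (simp add: continuous_on_eq_continuous_at)
  qed
  then have "continuous_on UNIV g"
    by (simp add: continuous_at_imp_continuous_on)
  then have "continuous_on {0..1} k"
    unfolding k_def by (auto intro!: continuous_intros intro: continuous_on_compose2)
  then obtain t0 where t0: "t0 \<in> {0..1}" "\<And>s. s \<in> {0..1} \<Longrightarrow> k t0 \<le> k s"
    using continuous_attains_inf[of "{0..1}" k] by auto
  have "k 0 = k 1"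
    by (simp add: k_def m_def)
  \<comment> \<open>The minimum has to be attained at some point that leaves room to its right.\<close>
  then obtain t where t: "0 \<le> t" "t < 1" and min: "\<And>s. s \<in> {0..1} \<Longrightarrow> k t \<le> k s"
    using t0 by (cases "t0 = 1") (force intro: that[of 0], force intro: that[of t0])
  let ?z = "a + t *\<^sub>R h"
  have quot: "m \<le> (g (?z + s *\<^sub>R h) - g ?z) / s" if "0 < s" "s < 1 - t" for s
    using min[of "t + s"] t that by (simp add: k_def field_simps scaleR_add_left)
  have "ereal m \<le> clarke_dir_deriv g ?z h"
  proof (rule ccontr)
    assume "\<not> ereal m \<le> clarke_dir_deriv g ?z h"
    then have "eventually (\<lambda>(y, s). (g (y + s *\<^sub>R h) - g y) / s < m) (nhds ?z \<times>\<^sub>F at_right (0::real))"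
      unfolding clarke_dir_deriv_def not_le by (auto dest: Limsup_lessD simp: split_def)
    then obtain P R where P: "eventually P (nhds ?z)" and R: "eventually R (at_right (0::real))"
      and PR: "\<And>y s. P y \<Longrightarrow> R s \<Longrightarrow> (g (y + s *\<^sub>R h) - g y) / s < m"
      unfolding eventually_prod_filter by auto
    have "eventually (\<lambda>s. s < 1 - t) (at_right (0::real))"
      using t by (intro order_tendstoD(2)[OF tendsto_ident_at]) simp
    with R eventually_at_right_less[of "0::real"]
    have "eventually (\<lambda>s. R s \<and> 0 < s \<and> s < 1 - t) (at_right 0)"
      by eventually_elim simp
    then obtain s where "R s" "0 < s" "s < 1 - t"
      using eventually_happens'[OF trivial_limit_at_right_real] by blast
    with PR[OF eventually_nhds_x_imp_x[OF P]] quot show False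
      by fastforce
  qed
  moreover obtain L where "L-lipschitz_on (ball ?z 1) g" using lip by blast
  then obtain e' where "e' \<in> clarke_subdifferential g ?z"
    "ereal (blinfun_apply e' h) = clarke_dir_deriv g ?z h"
    by (rule clarke_subgradient_attaining) auto
  ultimately show thesis
    using t that unfolding m_def by (metis ereal_less_eq(3))
qed

section \<open>Young functions and the Luxemburg norm\<close>

lemma young_function_nonneg: "young_function \<psi> \<Longrightarrow> 0 \<le> \<psi> e"
  by (simp add: young_function_def)

lemma young_function_contract:
  assumes "young_function \<psi>" "0 \<le> t" "t \<le> 1"
  shows "\<psi> (t *\<^sub>R e) \<le> \<psi> e"
proof -
  have "\<psi> ((1 - t) *\<^sub>R 0 + t *\<^sub>R e) \<le> ereal (1 - t) * \<psi> 0 + ereal t * \<psi> e"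
    using assms unfolding young_function_def by (metis atLeastAtMost_iff)
  then have "\<psi> (t *\<^sub>R e) \<le> ereal t * \<psi> e"
    using assms(1) by (simp add: young_function_def)
  also have "\<dots> \<le> 1 * \<psi> e"
    using assms by (intro ereal_mult_right_mono young_function_nonneg) (simp_all add: one_ereal_def)
  finally show ?thesis by simp
qed

lemma young_inequality:
  fixes \<phi> :: "'a \<Rightarrow> 'e::real_normed_vector \<Rightarrow> ereal"
  assumes "conjugate_integrand \<phi> \<omega> e' \<le> ereal a" "\<phi> \<omega> e \<le> ereal b"
  shows "blinfun_apply e' e \<le> a + b"
proof -
  have "ereal (blinfun_apply e' e) - \<phi> \<omega> e \<le> conjugate_integrand \<phi> \<omega> e'"
    unfolding conjugate_integrand_def by (rule SUP_upper) simp
  with assms(1) have "ereal (blinfun_apply e' e) - \<phi> \<omega> e \<le> ereal a"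
    by (rule order_trans[rotated])
  with assms(2) show ?thesis
    by (cases "\<phi> \<omega> e") auto
qed

lemma upper_integral_mono:
  assumes "AE \<omega> in M. v \<omega> \<le> w \<omega>"
  shows "upper_integral M v \<le> upper_integral M w"
proof -
  have "AE \<omega> in M. v \<omega> \<le> ereal (u \<omega>)" if "AE \<omega> in M. w \<omega> \<le> ereal (u \<omega>)" for u :: "_ \<Rightarrow> real"
    using assms that by eventually_elim (rule order_trans)
  then show ?thesis
    unfolding upper_integral_def by (intro INF_superset_mono) blast+
qed

text \<open>Some \<open>t < B\<close> satisfies \<open>I\<^sub>\<phi>(x / t) \<le> 1\<close>, and \<open>\<phi>\<close> does not increase when its argument is
  shrunk by \<open>t / B\<close>. The upper integral is an infimum that need not be attained; the bound 2 leaves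
  room for choosing an actual majorant.\<close>

lemma L_Young_majorant:
  fixes x :: "'a \<Rightarrow> 'e::real_normed_vector"
  assumes \<phi>: "young_integrand M \<phi>" and x: "x \<in> L_Young M \<phi>" and B: "norm_Young M \<phi> x < B"
  obtains v where "integrable M v" "integral\<^sup>L M v \<le> 2" "AE \<omega> in M. \<phi> \<omega> ((1 / B) *\<^sub>R x \<omega>) \<le> ereal (v \<omega>)"
proof -
  have "{t. t > 0 \<and> x \<in> scaled_sublevel M \<phi> t} \<noteq> {}"
    using x by (auto simp: L_Young_def)
  then obtain t where t: "0 < t" "t < B" and "x \<in> scaled_sublevel M \<phi> t"
    using cInf_lessD[OF _ B[unfolded norm_Young_def]] by auto
  then obtain y where y: "integral_functional M \<phi> y \<le> 1" and xy: "\<And>\<omega>. x \<omega> = t *\<^sub>R y \<omega>"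
    by (auto simp: scaled_sublevel_def)
  have "\<phi> \<omega> ((1 / B) *\<^sub>R x \<omega>) \<le> \<phi> \<omega> (y \<omega>)" if "\<omega> \<in> space M" for \<omega>
    using young_function_contract[of "\<phi> \<omega>" "t / B" "y \<omega>"] \<phi> that t
    by (simp add: young_integrand_def xy)
  then have "upper_integral M (\<lambda>\<omega>. \<phi> \<omega> ((1 / B) *\<^sub>R x \<omega>)) \<le> 1"
    using y upper_integral_mono[of "\<lambda>\<omega>. \<phi> \<omega> ((1 / B) *\<^sub>R x \<omega>)" "\<lambda>\<omega>. \<phi> \<omega> (y \<omega>)" M]
    unfolding integral_functional_def by (auto intro: order_trans)
  also have "(1::ereal) < 2" by simp
  finally obtain v :: "'a \<Rightarrow> real" where "integrable M v" "ereal (integral\<^sup>L M v) < 2"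
    "AE \<omega> in M. \<phi> \<omega> ((1 / B) *\<^sub>R x \<omega>) \<le> ereal (v \<omega>)"
    unfolding upper_integral_def INF_less_iff by auto
  moreover from this(2) have "integral\<^sup>L M v \<le> 2"
    by (metis ereal_less(2) ereal_less_eq(3) less_imp_le numeral_eq_ereal)
  ultimately show thesis
    by (intro that)
qed

text \<open>The mean value inequality is used from \<open>x0 + r x\<close> back to \<open>x0\<close>, in which direction the increment
  of \<open>g\<close> is \<open>- r\<close> times the difference quotient. The intermediate point is \<open>x0 + e\<close> with
  \<open>e = (1 - t) r x\<close>, and \<open>\<beta> e\<close> is \<open>x / B\<close> scaled by the factor \<open>(1 - t) \<beta> r B \<le> 1\<close>, so that a
  bound for \<open>\<phi>\<close> at \<open>x / B\<close> controls both terms of Young's inequality.\<close>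

lemma negative_quotient_bound:
  fixes g :: "'e::real_normed_vector \<Rightarrow> real"
    and \<phi> :: "'a \<Rightarrow> 'e \<Rightarrow> ereal"
  assumes lip: "\<And>z \<rho>. \<exists>L. L-lipschitz_on (ball z \<rho>) g"
    and young: "young_function (\<phi> \<omega>)"
    and growth: "\<And>e. (SUP e' \<in> clarke_subdifferential g (x0 + e).
        conjugate_integrand \<phi> \<omega> (l *\<^sub>R e')) \<le> ereal c * \<phi> \<omega> (\<beta> *\<^sub>R e) + ereal u"
    and v: "\<phi> \<omega> ((1 / B) *\<^sub>R x) \<le> ereal v"
    and pos: "c > 0" "l > 0" "\<beta> > 0" "B > 0" "r > 0" and small: "\<beta> * r * B \<le> 1"
  shows "max 0 (- ((g (x0 + r *\<^sub>R x) - g x0) / r)) \<le> B / l * ((1 + c) * v + \<bar>u\<bar>)"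
proof -
  obtain t e' where t: "0 \<le> t" "t < 1"
    and e': "e' \<in> clarke_subdifferential g ((x0 + r *\<^sub>R x) + t *\<^sub>R (- (r *\<^sub>R x)))"
    and mv: "g ((x0 + r *\<^sub>R x) + - (r *\<^sub>R x)) - g (x0 + r *\<^sub>R x) \<le> blinfun_apply e' (- (r *\<^sub>R x))"
    using clarke_mean_value_inequality[OF lip] by blast
  define e where "e = ((1 - t) * r) *\<^sub>R x"
  have "(x0 + r *\<^sub>R x) + t *\<^sub>R (- (r *\<^sub>R x)) = x0 + e"
    by (simp add: e_def algebra_simps)
  with e' have "conjugate_integrand \<phi> \<omega> (l *\<^sub>R e')
      \<le> (SUP e' \<in> clarke_subdifferential g (x0 + e). conjugate_integrand \<phi> \<omega> (l *\<^sub>R e'))"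
    by (intro SUP_upper) metis
  also have "\<dots> \<le> ereal c * \<phi> \<omega> (\<beta> *\<^sub>R e) + ereal u"
    by (rule growth)
  also have "\<phi> \<omega> (\<beta> *\<^sub>R e) \<le> \<phi> \<omega> ((1 / B) *\<^sub>R x)"
  proof -
    have "(1 - t) * (\<beta> * r * B) \<le> 1"
      using mult_mono[of "1 - t" 1 "\<beta> * r * B" 1] t small pos by simp
    then have "\<phi> \<omega> (((1 - t) * (\<beta> * r * B)) *\<^sub>R ((1 / B) *\<^sub>R x)) \<le> \<phi> \<omega> ((1 / B) *\<^sub>R x)"
      using young t pos by (intro young_function_contract) auto
    moreover have "((1 - t) * (\<beta> * r * B)) *\<^sub>R ((1 / B) *\<^sub>R x) = \<beta> *\<^sub>R e"
      using pos by (simp add: e_def mult_ac)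
    ultimately show ?thesis by simp
  qed
  also note v
  finally have conj: "conjugate_integrand \<phi> \<omega> (l *\<^sub>R e') \<le> ereal (c * v + u)"
    using pos by (simp add: add_right_mono ereal_mult_left_mono)
  have "\<phi> \<omega> (- ((1 / B) *\<^sub>R x)) \<le> ereal v"
    using young v by (simp add: young_function_def)
  from young_inequality[OF conj this]
  have "l / B * - blinfun_apply e' x \<le> (1 + c) * v + u"
    by (simp add: blinfun.bilinear_simps algebra_simps)
  then have "- blinfun_apply e' x \<le> B / l * ((1 + c) * v + u)"
    using pos by (simp add: field_simps)
  also have "\<dots> \<le> B / l * ((1 + c) * v + \<bar>u\<bar>)"
    using pos by (intro mult_left_mono) auto
  finally have "- blinfun_apply e' x \<le> B / l * ((1 + c) * v + \<bar>u\<bar>)" .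
  moreover have "- ((g (x0 + r *\<^sub>R x) - g x0) / r) \<le> - blinfun_apply e' x"
    using mv pos by (simp add: blinfun.bilinear_simps field_simps)
  moreover have "0 \<le> v"
    using order_trans[OF young_function_nonneg[OF young] v] by simp
  then have "0 \<le> B / l * ((1 + c) * v + \<bar>u\<bar>)"
    using pos by simp
  ultimately show ?thesis
    by linarith
qed

section \<open>A criterion for uniform integrability\<close>

text \<open>Both tails come from dominated convergence: the part of \<open>k\<close> where \<open>k > i\<close> and the part where
  \<open>k \<le> 1 / (j + 1)\<close> become negligible. Below the level \<open>i\<close> a set of measure at most \<open>\<eta>\<close> contributes
  at most \<open>i \<eta>\<close>, and \<open>K = {k > 1 / (j + 1)}\<close> has finite measure as \<open>k\<close> is integrable.\<close>

lemma integrable_tails_small: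
  fixes k :: "'a \<Rightarrow> real"
  assumes k: "integrable M k" "\<And>\<omega>. 0 \<le> k \<omega>" and \<epsilon>: "\<epsilon> > 0"
  obtains \<eta> K where "\<eta> > 0" "K \<in> sets M" "emeasure M K < \<infinity>"
    "\<And>A. A \<in> sets M \<Longrightarrow> emeasure M A \<le> ennreal \<eta> \<Longrightarrow> (\<integral>\<^sup>+\<omega>. ennreal (k \<omega> * indicator A \<omega>) \<partial>M) \<le> ennreal \<epsilon>"
    "(\<integral>\<^sup>+\<omega>. ennreal (k \<omega> * indicator (space M - K) \<omega>) \<partial>M) \<le> ennreal \<epsilon>"
proof -
  note [measurable] = borel_measurable_integrable[OF k(1)]
  \<comment> \<open>Truncations of \<open>k\<close> that vanish eventually at each point have small integrals.\<close>
  have small: "\<exists>j. (\<integral>\<^sup>+\<omega>. ennreal (s j \<omega>) \<partial>M) \<le> ennreal \<epsilon>'"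
    if [measurable]: "\<And>j. s j \<in> borel_measurable M" and s: "\<And>j \<omega>. 0 \<le> s j \<omega>" "\<And>j \<omega>. s j \<omega> \<le> k \<omega>"
      and lim: "\<And>\<omega>. eventually (\<lambda>j. s j \<omega> = 0) sequentially" and \<epsilon>': "\<epsilon>' > 0"
    for s :: "nat \<Rightarrow> 'a \<Rightarrow> real" and \<epsilon>'
  proof -
    have "(\<lambda>j. integral\<^sup>L M (s j)) \<longlonglongrightarrow> integral\<^sup>L M (\<lambda>_. 0)"
      using s by (intro integral_dominated_convergence[OF _ _ k(1)] AE_I2 tendsto_eventually lim) auto
    then have "eventually (\<lambda>j. integral\<^sup>L M (s j) < \<epsilon>') sequentially"
      using \<epsilon>' by (intro order_tendstoD) auto
    then obtain j where "integral\<^sup>L M (s j) < \<epsilon>'"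
      by (auto simp: eventually_sequentially)
    moreover have "integrable M (s j)"
      using s by (intro Bochner_Integration.integrable_bound[OF k(1)]) (auto simp: k(2))
    ultimately show ?thesis
      using s(1) by (intro exI[of _ j]) (simp add: nn_integral_eq_integral ennreal_leI)
  qed
  have "\<exists>j::nat. (\<integral>\<^sup>+\<omega>. ennreal (if real j < k \<omega> then k \<omega> else 0) \<partial>M) \<le> ennreal (\<epsilon> / 2)"
  proof (rule small)
    fix \<omega>
    obtain i where "k \<omega> \<le> real i" using real_arch_simple by blast
    then show "eventually (\<lambda>j. (if real j < k \<omega> then k \<omega> else 0) = 0) sequentially"
      unfolding eventually_sequentially by (intro exI[of _ i]) auto
  qed (use k \<epsilon> in auto)
  then obtain i :: nat
    where i: "(\<integral>\<^sup>+\<omega>. ennreal (if real i < k \<omega> then k \<omega> else 0) \<partial>M) \<le> ennreal (\<epsilon> / 2)" ..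
  have "\<exists>j::nat. (\<integral>\<^sup>+\<omega>. ennreal (if k \<omega> \<le> 1 / real (Suc j) then k \<omega> else 0) \<partial>M) \<le> ennreal \<epsilon>"
  proof (rule small)
    fix \<omega>
    show "eventually (\<lambda>j. (if k \<omega> \<le> 1 / real (Suc j) then k \<omega> else 0) = 0) sequentially"
    proof (cases "k \<omega> = 0")
      case False
      then have "eventually (\<lambda>j. 1 / real (Suc j) < k \<omega>) sequentially"
        using k(2)[of \<omega>] by (intro order_tendstoD(2)[OF LIMSEQ_Suc[OF lim_1_over_n]]) simp
      then show ?thesis by eventually_elim auto
    qed simp
  qed (use k \<epsilon> in auto)
  then obtain j :: nat
    where j: "(\<integral>\<^sup>+\<omega>. ennreal (if k \<omega> \<le> 1 / real (Suc j) then k \<omega> else 0) \<partial>M) \<le> ennreal \<epsilon>" ..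
  define \<eta> where "\<eta> = \<epsilon> / (2 * real (Suc i))"
  define K where "K = {\<omega> \<in> space M. 1 / real (Suc j) < k \<omega>}"
  show thesis
  proof
    show "\<eta> > 0" using \<epsilon> by (simp add: \<eta>_def)
    show K: "K \<in> sets M" unfolding K_def by measurable
    have "emeasure M K = (\<integral>\<^sup>+\<omega>. indicator K \<omega> \<partial>M)"
      using K by simp
    also have "\<dots> \<le> (\<integral>\<^sup>+\<omega>. ennreal (real (Suc j) * k \<omega>) \<partial>M)"
    proof (rule nn_integral_mono)
      fix \<omega>
      have "1 \<le> real (Suc j) * k \<omega>" if "1 / real (Suc j) < k \<omega>"
        using that by (simp add: field_simps)
      then show "indicator K \<omega> \<le> ennreal (real (Suc j) * k \<omega>)"
        by (auto simp: K_def indicator_def simp del: of_nat_Suc)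
    qed
    also have "\<dots> = ennreal (integral\<^sup>L M (\<lambda>\<omega>. real (Suc j) * k \<omega>))"
      using k by (intro nn_integral_eq_integral) auto
    finally show "emeasure M K < \<infinity>"
      using le_less_trans by fastforce
    have "(\<integral>\<^sup>+\<omega>. ennreal (k \<omega> * indicator (space M - K) \<omega>) \<partial>M)
        \<le> (\<integral>\<^sup>+\<omega>. ennreal (if k \<omega> \<le> 1 / real (Suc j) then k \<omega> else 0) \<partial>M)"
      by (intro nn_integral_mono ennreal_leI) (auto simp: K_def indicator_def not_less)
    with j show "(\<integral>\<^sup>+\<omega>. ennreal (k \<omega> * indicator (space M - K) \<omega>) \<partial>M) \<le> ennreal \<epsilon>"
      by (rule order_trans[rotated])
  next
    fix A
    assume [measurable]: "A \<in> sets M" and A: "emeasure M A \<le> ennreal \<eta>"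
    have "(\<integral>\<^sup>+\<omega>. ennreal (k \<omega> * indicator A \<omega>) \<partial>M)
        \<le> (\<integral>\<^sup>+\<omega>. ennreal (if real i < k \<omega> then k \<omega> else 0) + ennreal (real i) * indicator A \<omega> \<partial>M)"
      using k(2) by (intro nn_integral_mono) (auto simp: indicator_def not_less intro: ennreal_leI)
    also have "\<dots> = (\<integral>\<^sup>+\<omega>. ennreal (if real i < k \<omega> then k \<omega> else 0) \<partial>M) + ennreal (real i) * emeasure M A"
      by (simp add: nn_integral_add nn_integral_cmult_indicator)
    also have "\<dots> \<le> ennreal (\<epsilon> / 2) + ennreal (real i) * ennreal \<eta>"
      using A by (intro add_mono mult_left_mono i) auto
    also have "\<dots> = ennreal (\<epsilon> / 2 + real i * \<eta>)"
      using \<epsilon> by (subst ennreal_plus) (auto simp: \<eta>_def ennreal_mult simp del: times_divide_eq_right of_nat_Suc)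
    also have "\<dots> \<le> ennreal \<epsilon>"
      using \<epsilon> by (intro ennreal_leI) (simp add: \<eta>_def field_simps)
    finally show "(\<integral>\<^sup>+\<omega>. ennreal (k \<omega> * indicator A \<omega>) \<partial>M) \<le> ennreal \<epsilon>" .
  qed
qed

text \<open>The function \<open>k\<close> may depend on \<open>\<epsilon>\<close> but not on \<open>w\<close>, whereas the error \<open>v\<close> may depend on both.
  On any set the integral of \<open>\<bar>w\<bar>\<close> exceeds that of \<open>k\<close> by at most \<open>\<epsilon>\<close>, so the uniform integrability
  of the single function \<open>k\<close> carries over to \<open>X\<close>.\<close>

lemma uniformly_integrable_if_almost_dominated:
  fixes X :: "('a \<Rightarrow> real) set"
  assumes meas: "\<And>w. w \<in> X \<Longrightarrow> w \<in> borel_measurable M"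
    and dom: "\<And>\<epsilon>. \<epsilon> > 0 \<Longrightarrow> \<exists>k. integrable M k \<and> (\<forall>\<omega>. 0 \<le> k \<omega>) \<and>
       (\<forall>w\<in>X. \<exists>v. integrable M v \<and> integral\<^sup>L M v \<le> \<epsilon> \<and> (AE \<omega> in M. 0 \<le> v \<omega> \<and> \<bar>w \<omega>\<bar> \<le> v \<omega> + k \<omega>))"
  shows "uniformly_integrable M X"
proof -
  have bound: "\<exists>k. integrable M k \<and> (\<forall>\<omega>. 0 \<le> k \<omega>) \<and> (\<forall>A\<in>sets M.
      (SUP w\<in>X. L1_norm M (\<lambda>\<omega>. w \<omega> * indicator A \<omega>)) \<le>
        ennreal \<epsilon> + (\<integral>\<^sup>+\<omega>. ennreal (k \<omega> * indicator A \<omega>) \<partial>M))" if \<epsilon>: "\<epsilon> > 0" for \<epsilon> :: real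
  proof -
    obtain k where k: "integrable M k" "\<forall>\<omega>. 0 \<le> k \<omega>"
      and w: "\<forall>w\<in>X. \<exists>v. integrable M v \<and> integral\<^sup>L M v \<le> \<epsilon> \<and>
        (AE \<omega> in M. 0 \<le> v \<omega> \<and> \<bar>w \<omega>\<bar> \<le> v \<omega> + k \<omega>)"
      using dom[OF \<epsilon>] by blast
    note [measurable] = borel_measurable_integrable[OF k(1)]
    have "L1_norm M (\<lambda>\<omega>. w \<omega> * indicator A \<omega>)
        \<le> ennreal \<epsilon> + (\<integral>\<^sup>+\<omega>. ennreal (k \<omega> * indicator A \<omega>) \<partial>M)"
      if wX: "w \<in> X" and [measurable]: "A \<in> sets M" for w A
    proof -
      obtain v where v: "integrable M v" "integral\<^sup>L M v \<le> \<epsilon>"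
        and ae: "AE \<omega> in M. 0 \<le> v \<omega> \<and> \<bar>w \<omega>\<bar> \<le> v \<omega> + k \<omega>"
        using w wX by blast
      note [measurable] = borel_measurable_integrable[OF v(1)]
      have "L1_norm M (\<lambda>\<omega>. w \<omega> * indicator A \<omega>)
          \<le> (\<integral>\<^sup>+\<omega>. ennreal (v \<omega>) + ennreal (k \<omega> * indicator A \<omega>) \<partial>M)"
        unfolding L1_norm_def
      proof (rule nn_integral_mono_AE)
        show "AE \<omega> in M. ennreal \<bar>w \<omega> * indicator A \<omega>\<bar> \<le> ennreal (v \<omega>) + ennreal (k \<omega> * indicator A \<omega>)"
          using ae
        proof eventually_elim
          case (elim \<omega>)
          then have "ennreal \<bar>w \<omega> * indicator A \<omega>\<bar> \<le> ennreal (v \<omega> + k \<omega> * indicator A \<omega>)"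
            by (intro ennreal_leI) (auto simp: indicator_def)
          with elim k(2) show ?case by (simp add: ennreal_plus)
        qed
      qed
      also have "\<dots> = ennreal (integral\<^sup>L M v) + (\<integral>\<^sup>+\<omega>. ennreal (k \<omega> * indicator A \<omega>) \<partial>M)"
        using v(1) ae by (simp add: nn_integral_add nn_integral_eq_integral)
      also have "\<dots> \<le> ennreal \<epsilon> + (\<integral>\<^sup>+\<omega>. ennreal (k \<omega> * indicator A \<omega>) \<partial>M)"
        using v(2) by (intro add_right_mono ennreal_leI)
      finally show ?thesis .
    qed
    with k show ?thesis
      by (intro exI[of _ k]) (auto intro: SUP_least)
  qed
  have bdd: "(SUP w\<in>X. L1_norm M w) < \<infinity>"
  proof -
    obtain k where k: "integrable M k" "\<forall>\<omega>. 0 \<le> k \<omega>"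
      and "(SUP w\<in>X. L1_norm M (\<lambda>\<omega>. w \<omega> * indicator (space M) \<omega>)) \<le>
        ennreal 1 + (\<integral>\<^sup>+\<omega>. ennreal (k \<omega> * indicator (space M) \<omega>) \<partial>M)"
      using bound[of 1] by auto
    moreover have "L1_norm M (\<lambda>\<omega>. w \<omega> * indicator (space M) \<omega>) = L1_norm M w" for w
      unfolding L1_norm_def by (intro nn_integral_cong) simp
    moreover have "(\<integral>\<^sup>+\<omega>. ennreal (k \<omega> * indicator (space M) \<omega>) \<partial>M) = (\<integral>\<^sup>+\<omega>. ennreal (k \<omega>) \<partial>M)"
      by (intro nn_integral_cong) simp
    ultimately have "(SUP w\<in>X. L1_norm M w) \<le> ennreal 1 + ennreal (integral\<^sup>L M k)"
      by (simp add: nn_integral_eq_integral)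
    then show ?thesis
      using le_less_trans by fastforce
  qed
  show ?thesis
    unfolding uniformly_integrable_def
  proof (intro conjI ballI allI impI bdd)
    fix w assume w: "w \<in> X"
    then have "L1_norm M w < \<infinity>"
      using bdd SUP_upper[OF w, of "L1_norm M"] le_less_trans by blast
    with meas[OF w] show "integrable M w"
      by (simp add: L1_norm_def integrable_iff_bounded)
  next
    fix \<epsilon> :: real
    assume \<epsilon>: "\<epsilon> > 0"
    \<comment> \<open>Thirds, because the two errors have to add up to strictly less than \<open>\<epsilon>\<close>.\<close>
    obtain k where k: "integrable M k" "\<forall>\<omega>. 0 \<le> k \<omega>"
      and X: "\<forall>A\<in>sets M. (SUP w\<in>X. L1_norm M (\<lambda>\<omega>. w \<omega> * indicator A \<omega>)) \<le>
        ennreal (\<epsilon> / 3) + (\<integral>\<^sup>+\<omega>. ennreal (k \<omega> * indicator A \<omega>) \<partial>M)"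
      using bound[of "\<epsilon> / 3"] \<epsilon> by auto
    obtain \<eta> K where \<eta>: "\<eta> > 0" and K: "K \<in> sets M" "emeasure M K < \<infinity>"
      and tails: "\<And>A. A \<in> sets M \<Longrightarrow> emeasure M A \<le> ennreal \<eta> \<Longrightarrow>
        (\<integral>\<^sup>+\<omega>. ennreal (k \<omega> * indicator A \<omega>) \<partial>M) \<le> ennreal (\<epsilon> / 3)"
        "(\<integral>\<^sup>+\<omega>. ennreal (k \<omega> * indicator (space M - K) \<omega>) \<partial>M) \<le> ennreal (\<epsilon> / 3)"
      using integrable_tails_small[OF k(1), of "\<epsilon> / 3"] k(2) \<epsilon> by auto
    have less: "(SUP w\<in>X. L1_norm M (\<lambda>\<omega>. w \<omega> * indicator A \<omega>)) < ennreal \<epsilon>"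
      if A: "A \<in> sets M" and "(\<integral>\<^sup>+\<omega>. ennreal (k \<omega> * indicator A \<omega>) \<partial>M) \<le> ennreal (\<epsilon> / 3)" for A
    proof -
      have "(SUP w\<in>X. L1_norm M (\<lambda>\<omega>. w \<omega> * indicator A \<omega>)) \<le> ennreal (\<epsilon> / 3) + ennreal (\<epsilon> / 3)"
        using X A that(2) by (meson add_left_mono order_trans)
      also have "\<dots> = ennreal (\<epsilon> / 3 + \<epsilon> / 3)"
        using \<epsilon> by (intro ennreal_plus[symmetric]) auto
      also have "\<dots> < ennreal \<epsilon>"
        using \<epsilon> by (intro ennreal_lessI) auto
      finally show ?thesis .
    qed
    show "\<exists>\<eta>>0. \<exists>K\<in>sets M. emeasure M K < \<infinity> \<and>
        (\<forall>A\<in>sets M. emeasure M A \<le> ennreal \<eta> \<longrightarrow>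
           (SUP u\<in>X. L1_norm M (\<lambda>\<omega>. u \<omega> * indicator A \<omega>)) < ennreal \<epsilon>) \<and>
        (SUP u\<in>X. L1_norm M (\<lambda>\<omega>. u \<omega> * indicator (space M - K) \<omega>)) < ennreal \<epsilon>"
      using \<eta> K less tails by (intro exI[of _ \<eta>] conjI bexI[of _ K]) auto
  qed
qed

section \<open>Lower compactness of the integrand\<close>

theorem proposition8p12:
  fixes M :: "'a measure"
    and \<phi> :: "'a \<Rightarrow> 'e::{banach, second_countable_topology} \<Rightarrow> ereal"
    and f :: "'a \<Rightarrow> 'e \<Rightarrow> real"
    and x\<^sub>0 :: "'a \<Rightarrow> 'e"
    and c l\<^sub>0 :: real
  assumes "sigma_finite_measure M"
    and "complete_measure M"
    and "young_integrand M \<phi>"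
    and "x\<^sub>0 \<in> L_Young M \<phi>"
    and "case_prod f \<in> borel_measurable (M \<Otimes>\<^sub>M borel)"
    and "AE \<omega> in M. \<forall>z r. \<exists>L. L-lipschitz_on (ball z r) (f \<omega>)"
    and "c > 0" and "l\<^sub>0 > 0"
    and "\<forall>l>l\<^sub>0. \<exists>\<beta>>0. \<exists>u :: 'a \<Rightarrow> real. integrable M u \<and>
           (AE \<omega> in M. \<forall>e.
              (SUP e' \<in> clarke_subdifferential (f \<omega>) (x\<^sub>0 \<omega> + e).
                 conjugate_integrand \<phi> \<omega> (l *\<^sub>R e'))
              \<le> ereal c * \<phi> \<omega> (\<beta> *\<^sub>R e) + ereal (u \<omega>))"
  shows "frechet_differential_lower_compact M (L_Young M \<phi>) (norm_Young M \<phi>) f x\<^sub>0"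
  unfolding frechet_differential_lower_compact_def
proof (intro allI impI)
  fix r :: "nat \<Rightarrow> real" and x :: "nat \<Rightarrow> 'a \<Rightarrow> 'e"
  assume r: "\<forall>n. r n > 0" "r \<longlonglongrightarrow> 0" and x: "\<forall>n. x n \<in> L_Young M \<phi>"
    and "bdd_above (range (\<lambda>n. norm_Young M \<phi> (x n)))"
  then obtain B0 where B0: "\<And>n. norm_Young M \<phi> (x n) \<le> B0"
    by (auto simp: bdd_above_def)
  \<comment> \<open>\<open>B\<close> is strictly above all norms, as the norm itself need not be an admissible scaling.\<close>
  define B where "B = max B0 0 + 1"
  have B: "B > 0" "\<And>n. norm_Young M \<phi> (x n) < B"
    using le_less_trans[OF B0, of B] by (simp_all add: B_def)
  have "\<exists>v. integrable M v \<and> integral\<^sup>L M v \<le> 2 \<and> (AE \<omega> in M. \<phi> \<omega> ((1 / B) *\<^sub>R x n \<omega>) \<le> ereal (v \<omega>))" for n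
    using L_Young_majorant[OF assms(3) spec[OF x, of n] B(2)[of n]] by blast
  then obtain v where v: "\<And>n. integrable M (v n)" "\<And>n. integral\<^sup>L M (v n) \<le> 2"
    "\<And>n. AE \<omega> in M. \<phi> \<omega> ((1 / B) *\<^sub>R x n \<omega>) \<le> ereal (v n \<omega>)"
    by metis
  have v_nonneg: "AE \<omega> in M. 0 \<le> v n \<omega>" for n
    using v(3)[of n] AE_space
  proof eventually_elim
    case (elim \<omega>)
    then have "0 \<le> \<phi> \<omega> ((1 / B) *\<^sub>R x n \<omega>)"
      using assms(3) by (intro young_function_nonneg) (simp add: young_integrand_def)
    with elim show ?case
      by (metis ereal_less_eq(5) order_trans)
  qed
  define w where "w n \<omega> = max 0 (- ((f \<omega> (x\<^sub>0 \<omega> + r n *\<^sub>R x n \<omega>) - f \<omega> (x\<^sub>0 \<omega>)) / r n))" for n \<omega>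
  have [measurable]: "x\<^sub>0 \<in> borel_measurable M" "x n \<in> borel_measurable M" for n
    using assms(4) x by (auto simp: L_Young_def)
  have f_comp: "(\<lambda>\<omega>. f \<omega> (y \<omega>)) \<in> borel_measurable M" if [measurable]: "y \<in> borel_measurable M" for y
    using measurable_compose[OF _ assms(5), of "\<lambda>\<omega>. (\<omega>, y \<omega>)" M] by simp
  have w_meas: "w n \<in> borel_measurable M" for n
    unfolding w_def by (intro borel_measurable_max borel_measurable_uminus borel_measurable_divide
        borel_measurable_diff borel_measurable_const f_comp) measurable
  have w_bound: "\<exists>N u. integrable M u \<and>
      (\<forall>n\<ge>N. AE \<omega> in M. w n \<omega> \<le> B / l * ((1 + c) * v n \<omega> + \<bar>u \<omega>\<bar>))" if l: "l > l\<^sub>0" for l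
  proof -
    obtain \<beta> u where \<beta>: "\<beta> > 0" and u: "integrable M u"
      and growth: "AE \<omega> in M. \<forall>e. (SUP e' \<in> clarke_subdifferential (f \<omega>) (x\<^sub>0 \<omega> + e).
        conjugate_integrand \<phi> \<omega> (l *\<^sub>R e')) \<le> ereal c * \<phi> \<omega> (\<beta> *\<^sub>R e) + ereal (u \<omega>)"
      using assms(9) l by blast
    have "eventually (\<lambda>n. r n < 1 / (\<beta> * B)) sequentially"
      using r(2) \<beta> B(1) by (intro order_tendstoD) auto
    then obtain N where N: "\<And>n. n \<ge> N \<Longrightarrow> r n < 1 / (\<beta> * B)"
      by (auto simp: eventually_sequentially)
    have "AE \<omega> in M. w n \<omega> \<le> B / l * ((1 + c) * v n \<omega> + \<bar>u \<omega>\<bar>)" if n: "n \<ge> N" for n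
      using growth assms(6) v(3)[of n] AE_space
    proof eventually_elim
      case (elim \<omega>)
      have "\<beta> * r n * B \<le> 1"
        using N[OF n] \<beta> B(1) by (simp add: field_simps)
      then show ?case
        unfolding w_def using elim assms(3,7,8) l \<beta> B(1) r(1)
        by (intro negative_quotient_bound[where \<phi> = \<phi> and \<omega> = \<omega> and \<beta> = \<beta>])
          (auto simp: young_integrand_def)
    qed
    with u show ?thesis by blast
  qed
  \<comment> \<open>One fixed admissible \<open>l\<close> suffices for integrability and determines \<open>n\<^sub>0\<close>; the smaller the
    error, the larger the \<open>l\<close> that will be used from some later index on.\<close>
  obtain n\<^sub>0 u\<^sub>1 where u1: "integrable M u\<^sub>1"
    and n0: "\<And>n. n \<ge> n\<^sub>0 \<Longrightarrow> AE \<omega> in M. w n \<omega> \<le> B / (l\<^sub>0 + 1) * ((1 + c) * v n \<omega> + \<bar>u\<^sub>1 \<omega>\<bar>)"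
    using w_bound[of "l\<^sub>0 + 1"] by auto
  have w_nonneg: "0 \<le> w n \<omega>" for n \<omega>
    by (simp add: w_def)
  have w_int: "integrable M (w n)" if "n \<ge> n\<^sub>0" for n
  proof (rule Bochner_Integration.integrable_bound[OF _ w_meas])
    show "integrable M (\<lambda>\<omega>. B / (l\<^sub>0 + 1) * ((1 + c) * v n \<omega> + \<bar>u\<^sub>1 \<omega>\<bar>))"
      using v(1) u1 by auto
    show "AE \<omega> in M. norm (w n \<omega>) \<le> norm (B / (l\<^sub>0 + 1) * ((1 + c) * v n \<omega> + \<bar>u\<^sub>1 \<omega>\<bar>))"
      using n0[OF that]
    proof eventually_elim
      case (elim \<omega>)
      then show ?case
        using abs_of_nonneg[OF w_nonneg[of n \<omega>]] order_trans[OF _ abs_ge_self]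
        by (simp only: real_norm_def)
    qed
  qed
  have "uniformly_integrable M (w ` {n\<^sub>0..})"
  proof (rule uniformly_integrable_if_almost_dominated)
    fix \<epsilon> :: real
    assume \<epsilon>: "\<epsilon> > 0"
    \<comment> \<open>The second entry makes \<open>B / l * (1 + c)\<close> times the bound 2 on the integrals at most \<open>\<epsilon>\<close>.\<close>
    define l where "l = max (l\<^sub>0 + 1) (2 * B * (1 + c) / \<epsilon>)"
    have l: "l > l\<^sub>0" "l > 0" "2 * B * (1 + c) / \<epsilon> \<le> l"
      using assms(8) by (auto simp: l_def)
    then have l_small: "B / l * (1 + c) * 2 \<le> \<epsilon>"
      using \<epsilon> by (simp add: field_simps)
    obtain N u where u: "integrable M u"
      and N: "\<And>n. n \<ge> N \<Longrightarrow> AE \<omega> in M. w n \<omega> \<le> B / l * ((1 + c) * v n \<omega> + \<bar>u \<omega>\<bar>)"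
      using w_bound[OF l(1)] by blast
    define k where "k \<omega> = B / l * \<bar>u \<omega>\<bar> + (\<Sum>n\<in>{n\<^sub>0..<N}. w n \<omega>)" for \<omega>
    have sum_nonneg: "0 \<le> (\<Sum>n\<in>{n\<^sub>0..<N}. w n \<omega>)" for \<omega>
      by (intro sum_nonneg w_nonneg)
    have first_nonneg: "0 \<le> B / l * \<bar>u \<omega>\<bar>" for \<omega>
      using B(1) l(2) by simp
    have "\<exists>v'. integrable M v' \<and> integral\<^sup>L M v' \<le> \<epsilon> \<and> (AE \<omega> in M. 0 \<le> v' \<omega> \<and> \<bar>w n \<omega>\<bar> \<le> v' \<omega> + k \<omega>)"
      if n: "n \<ge> n\<^sub>0" for n
    proof (cases "n \<ge> N")
      case True
      define a where "a = B / l * (1 + c)"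
      have a: "0 \<le> a" using B(1) l(2) assms(7) by (simp add: a_def)
      have "a * integral\<^sup>L M (v n) \<le> a * 2"
        using a v(2) by (rule mult_left_mono[rotated])
      then have "integral\<^sup>L M (\<lambda>\<omega>. a * v n \<omega>) \<le> \<epsilon>"
        using l_small by (simp add: a_def)
      moreover have "AE \<omega> in M. 0 \<le> a * v n \<omega> \<and> \<bar>w n \<omega>\<bar> \<le> a * v n \<omega> + k \<omega>"
        using N[OF True] v_nonneg[of n]
      proof eventually_elim
        case (elim \<omega>)
        have "w n \<omega> \<le> a * v n \<omega> + B / l * \<bar>u \<omega>\<bar>"
          using elim(1) by (simp add: a_def algebra_simps add_divide_distrib)
        then show ?case
          using elim(2) a sum_nonneg[of \<omega>] w_nonneg[of n \<omega>] by (simp add: k_def)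
      qed
      ultimately show ?thesis
        using v(1)[of n] by (intro exI[of _ "\<lambda>\<omega>. a * v n \<omega>"]) auto
    next
      case False
      have "w n \<omega> \<le> k \<omega>" for \<omega>
      proof -
        have "w n \<omega> \<le> (\<Sum>n\<in>{n\<^sub>0..<N}. w n \<omega>)"
          using False n w_nonneg by (intro member_le_sum) auto
        then show ?thesis using first_nonneg[of \<omega>] by (simp add: k_def)
      qed
      then show ?thesis
        using \<epsilon> w_nonneg by (intro exI[of _ "\<lambda>_. 0"]) simp
    qed
    moreover have "integrable M k"
      unfolding k_def
      by (intro Bochner_Integration.integrable_add Bochner_Integration.integrable_sum
          integrable_mult_right integrable_abs u w_int) auto
    moreover have "0 \<le> k \<omega>" for \<omega>
      unfolding k_def by (intro add_nonneg_nonneg first_nonneg sum_nonneg)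
    ultimately show "\<exists>k. integrable M k \<and> (\<forall>\<omega>. 0 \<le> k \<omega>) \<and> (\<forall>w\<in>w ` {n\<^sub>0..}. \<exists>v. integrable M v \<and>
        integral\<^sup>L M v \<le> \<epsilon> \<and> (AE \<omega> in M. 0 \<le> v \<omega> \<and> \<bar>w \<omega>\<bar> \<le> v \<omega> + k \<omega>))"
      by (intro exI[of _ k]) auto
  qed (use w_meas in auto)
  then show "\<exists>n\<^sub>0. uniformly_integrable M ((\<lambda>n \<omega>. max 0 (- ((f \<omega> (x\<^sub>0 \<omega> + r n *\<^sub>R x n \<omega>) -
      f \<omega> (x\<^sub>0 \<omega>)) / r n))) ` {n\<^sub>0..})"
    unfolding w_def by blast
qed

end
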